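(* Let $n\ge 1$ and let $\mathfrak{l}_{2n+1}^{J_0}$ be the complex Heisenberg Leibniz algebra (with $a=0$) with its basis $\{e_1,\dots,e_n,f_1,\dots,f_n,z\}$. Every derivation of $\mathfrak{l}_{2n+1}^{J_0}$ has, with respect to this basis, a matrix of the form $$\begin{pmatrix} A & C & 0\\ B & D & 0\\ \mu & \nu & \gamma\end{pmatrix},$$ where $\mu=(\mu_1,\dots,\mu_n)$ and $\nu=(\nu_1,\dots,\nu_n)$ are row vectors in $\mathbb{C}^n$, and, for some scalars $\alpha_1,\dots,\alpha_n,\beta_1\in\mathbb{C}$, $b_h\in\mathbb{C}$ ($h$ even, $n+1\le h\le 2n$) and $c_h\in\mathbb{C}$ ($h$ even, $2\le h\le n+1$), one has $\gamma=\alpha_1+\beta_1$ and the $n\times n$ blocks have entries as follows: (i) $A_{ij}=\alpha_{j-i+1}$ if $i\le j$ and $A_{ij}=0$ if $i>j$; (ii) $D_{ii}=\beta_1$, $D_{ij}=-\alpha_{i-j+1}$ if $i>j$, and $D_{ij}=0$ if $i<j$; (iii) $B_{ij}=(-1)^{i+1}b_{i+j}$ if $i+j$ is even and $i+j\ge n+1$, and $B_{ij}=0$ otherwise; (iv) $C_{ij}=(-1)^{i+1}c_{i+j}$ if $i+j$ is even and $i+j\le n+1$, and $C_{ij}=0$ otherwise.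
   Context: The Heisenberg Leibniz algebra $\mathfrak{l}_{2n+1}^{J_0}$ is the complex algebra with basis $\{e_1,\dots,e_n,f_1,\dots,f_n,z\}$ and bilinear bracket whose nonzero values on basis elements are $[e_i,f_i]=z$, $[f_i,e_i]=-z$ for $i=1,\dots,n$, and $[e_i,f_{i-1}]=[f_{i-1},e_i]=z$ for $i=2,\dots,n$. A derivation of an algebra $L$ with bracket $[-,-]$ is a linear map $d\colon L\to L$ with $d([x,y])=[d(x),y]+[x,d(y)]$ for all $x,y\in L$. The matrix of $d$ with respect to the ordered basis $(e_1,\dots,e_n,f_1,\dots,f_n,z)$ has as columns the coordinates of the images of the basis vectors. *)

theory Defs
  imports
    Complex_Main
    "Jordan_Normal_Form.Matrix"
    "Jordan_Normal_Form.VS_Connect"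
begin

section \<open>The Heisenberg Leibniz algebra\<close>

text \<open>
  The algebra is realised on \<open>carrier_vec (2 * n + 1)\<close>, with \<open>e\<^sub>1, \<dots>, e\<^sub>n, f\<^sub>1, \<dots>, f\<^sub>n, z\<close> the unit
  vectors in this order. Coordinates with respect to this basis are therefore vector entries.
  The indices of \<open>e\<close> and \<open>f\<close> start at 1, those of library vectors and matrices at 0.
\<close>

definition heis_e :: "nat \<Rightarrow> nat \<Rightarrow> complex vec" where
  "heis_e n i = unit_vec (2 * n + 1) (i - 1)"

definition heis_f :: "nat \<Rightarrow> nat \<Rightarrow> complex vec" where
  "heis_f n i = unit_vec (2 * n + 1) (n + i - 1)"

definition heis_z :: "nat \<Rightarrow> complex vec" where
  "heis_z n = unit_vec (2 * n + 1) (2 * n)"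

definition heis_basis :: "nat \<Rightarrow> complex vec list" where
  "heis_basis n = map (heis_e n) [1..<n + 1] @ map (heis_f n) [1..<n + 1] @ [heis_z n]"

definition coord_e :: "complex vec \<Rightarrow> nat \<Rightarrow> complex" where
  "coord_e x i = x $ (i - 1)"

definition coord_f :: "nat \<Rightarrow> complex vec \<Rightarrow> nat \<Rightarrow> complex" where
  "coord_f n x i = x $ (n + i - 1)"

text \<open>
  The bilinear extension of \<open>[e\<^sub>i, f\<^sub>i] = z\<close>, \<open>[f\<^sub>i, e\<^sub>i] = -z\<close> for \<open>1 \<le> i \<le> n\<close> and
  \<open>[e\<^sub>i, f\<^sub>i\<^sub>-\<^sub>1] = [f\<^sub>i\<^sub>-\<^sub>1, e\<^sub>i] = z\<close> for \<open>2 \<le> i \<le> n\<close>. The lemmas below show that it is bilinear and has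
  exactly these values on the basis.
\<close>

definition heis_bracket :: "nat \<Rightarrow> complex vec \<Rightarrow> complex vec \<Rightarrow> complex vec" where
  "heis_bracket n x y =
     ((\<Sum>i = 1..n. coord_e x i * coord_f n y i - coord_f n x i * coord_e y i) +
      (\<Sum>i = 2..n. coord_e x i * coord_f n y (i - 1) + coord_f n x (i - 1) * coord_e y i))
     \<cdot>\<^sub>v heis_z n"

lemma heis_basis_eq_unit_vecs: "heis_basis n = unit_vecs (2 * n + 1)"
  by (rule nth_equalityI)
    (auto simp: heis_basis_def heis_e_def heis_f_def heis_z_def unit_vecs_def nth_append
      simp del: upt_Suc)

lemma heis_bracket_closed: "heis_bracket n x y \<in> carrier_vec (2 * n + 1)"
  by (simp add: heis_bracket_def heis_z_def)

lemma heis_bracket_bilinear: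
  assumes "x \<in> carrier_vec (2 * n + 1)" "x' \<in> carrier_vec (2 * n + 1)"
    "y \<in> carrier_vec (2 * n + 1)" "y' \<in> carrier_vec (2 * n + 1)"
  shows "heis_bracket n (x + x') y = heis_bracket n x y + heis_bracket n x' y"
    and "heis_bracket n (c \<cdot>\<^sub>v x) y = c \<cdot>\<^sub>v heis_bracket n x y"
    and "heis_bracket n x (y + y') = heis_bracket n x y + heis_bracket n x y'"
    and "heis_bracket n x (c \<cdot>\<^sub>v y) = c \<cdot>\<^sub>v heis_bracket n x y"
proof -
  have add: "coord_e (u + v) i = coord_e u i + coord_e v i"
      "coord_f n (u + v) i = coord_f n u i + coord_f n v i"
      "coord_f n (u + v) (i - 1) = coord_f n u (i - 1) + coord_f n v (i - 1)"
    if "1 \<le> i" "i \<le> n" "u \<in> carrier_vec (2 * n + 1)" "v \<in> carrier_vec (2 * n + 1)" for i u v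
    using that by (simp_all add: coord_e_def coord_f_def)
  have smult: "coord_e (c \<cdot>\<^sub>v u) i = c * coord_e u i"
      "coord_f n (c \<cdot>\<^sub>v u) i = c * coord_f n u i"
      "coord_f n (c \<cdot>\<^sub>v u) (i - 1) = c * coord_f n u (i - 1)"
    if "1 \<le> i" "i \<le> n" "u \<in> carrier_vec (2 * n + 1)" for i u
    using that by (simp_all add: coord_e_def coord_f_def)
  have split: "a + b = (a1 + b1) + (a2 + b2)" if "a = a1 + a2" "b = b1 + b2"
    for a b a1 a2 b1 b2 :: complex
    using that by simp
  note cong = arg_cong[where f = "\<lambda>t. t \<cdot>\<^sub>v heis_z n"]
  show "heis_bracket n (x + x') y = heis_bracket n x y + heis_bracket n x' y"
    unfolding heis_bracket_def add_smult_distrib_vec[symmetric]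
    by (intro cong split; unfold sum.distrib[symmetric]; intro sum.cong refl)
      (auto simp: add[OF _ _ assms(1,2), unfolded One_nat_def] algebra_simps)
  show "heis_bracket n (c \<cdot>\<^sub>v x) y = c \<cdot>\<^sub>v heis_bracket n x y"
    unfolding heis_bracket_def smult_smult_assoc distrib_left sum_distrib_left
    by (intro cong arg_cong2[where f = "(+)"] sum.cong refl) (auto simp: smult[OF _ _ assms(1), unfolded One_nat_def] algebra_simps)
  show "heis_bracket n x (y + y') = heis_bracket n x y + heis_bracket n x y'"
    unfolding heis_bracket_def add_smult_distrib_vec[symmetric]
    by (intro cong split; unfold sum.distrib[symmetric]; intro sum.cong refl)
      (auto simp: add[OF _ _ assms(3,4), unfolded One_nat_def] algebra_simps)
  show "heis_bracket n x (c \<cdot>\<^sub>v y) = c \<cdot>\<^sub>v heis_bracket n x y"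
    unfolding heis_bracket_def smult_smult_assoc distrib_left sum_distrib_left
    by (intro cong arg_cong2[where f = "(+)"] sum.cong refl) (auto simp: smult[OF _ _ assms(3), unfolded One_nat_def] algebra_simps)
qed

lemma coord_basis:
  assumes "1 \<le> i" "i \<le> n" "1 \<le> j" "j \<le> n"
  shows "coord_e (heis_e n i) j = of_bool (j = i)" "coord_f n (heis_e n i) j = 0"
    "coord_e (heis_f n i) j = 0" "coord_f n (heis_f n i) j = of_bool (j = i)"
    "coord_e (heis_z n) j = 0" "coord_f n (heis_z n) j = 0"
  using assms by (auto simp: coord_e_def coord_f_def heis_e_def heis_f_def heis_z_def)

lemma heis_bracket_basis:
  assumes i: "1 \<le> i" "i \<le> n" and j: "1 \<le> j" "j \<le> n"
  shows "heis_bracket n (heis_e n i) (heis_f n j) =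
      (if j = i then heis_z n else if j = i - 1 then heis_z n else 0\<^sub>v (2 * n + 1))"
    and "heis_bracket n (heis_f n j) (heis_e n i) =
      (if j = i then - heis_z n else if j = i - 1 then heis_z n else 0\<^sub>v (2 * n + 1))"
    and "heis_bracket n (heis_e n i) (heis_e n j) = 0\<^sub>v (2 * n + 1)"
    and "heis_bracket n (heis_f n i) (heis_f n j) = 0\<^sub>v (2 * n + 1)"
    and "heis_bracket n (heis_e n i) (heis_z n) = 0\<^sub>v (2 * n + 1)"
    and "heis_bracket n (heis_z n) (heis_e n i) = 0\<^sub>v (2 * n + 1)"
    and "heis_bracket n (heis_f n i) (heis_z n) = 0\<^sub>v (2 * n + 1)"
    and "heis_bracket n (heis_z n) (heis_f n i) = 0\<^sub>v (2 * n + 1)"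
    and "heis_bracket n (heis_z n) (heis_z n) = 0\<^sub>v (2 * n + 1)"
proof -
  have zero: "0 \<cdot>\<^sub>v heis_z n = 0\<^sub>v (2 * n + 1)"
    by (auto simp: heis_z_def)
  have neg: "(- 1) \<cdot>\<^sub>v heis_z n = - heis_z n"
    by auto
  have s1: "(\<Sum>k = 1..n. of_bool (k = i) * of_bool (k = j)) = (of_bool (j = i) :: complex)"
  proof -
    have "(\<Sum>k = 1..n. of_bool (k = i) * of_bool (k = j)) =
        (\<Sum>k = 1..n. if k = i then of_bool (i = j) else (0 :: complex))"
      by (rule sum.cong) auto
    then show ?thesis using i by auto
  qed
  have s2: "(\<Sum>k = 2..n. of_bool (k = i) * of_bool (k - 1 = j)) = (of_bool (j = i - 1) :: complex)"
  proof -
    have "(\<Sum>k = 2..n. of_bool (k = i) * of_bool (k - 1 = j)) =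
        (\<Sum>k = 2..n. if k = i then of_bool (i - 1 = j) else (0 :: complex))"
      by (rule sum.cong) auto
    then show ?thesis using i j by auto
  qed
  have s1': "(\<Sum>k = 1..n. of_bool (k = j) * of_bool (k = i)) = (of_bool (j = i) :: complex)"
    using s1 by (simp only: mult.commute)
  have s2': "(\<Sum>k = 2..n. of_bool (k - 1 = j) * of_bool (k = i)) = (of_bool (j = i - 1) :: complex)"
    using s2 by (simp only: mult.commute)
  have ne: "j \<noteq> i - 1" if "j = i" using that i by auto
  have "heis_bracket n (heis_e n i) (heis_f n j) =
      (of_bool (j = i) + of_bool (j = i - 1)) \<cdot>\<^sub>v heis_z n"
    unfolding heis_bracket_def s1[symmetric] s2[symmetric]
    using i j by (intro arg_cong[where f = "\<lambda>t. t \<cdot>\<^sub>v heis_z n"] arg_cong2[where f = "(+)"] sum.cong)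
      (auto simp: coord_basis)
  then show "heis_bracket n (heis_e n i) (heis_f n j) =
      (if j = i then heis_z n else if j = i - 1 then heis_z n else 0\<^sub>v (2 * n + 1))"
    using ne zero by auto
  have "heis_bracket n (heis_f n j) (heis_e n i) =
      (- of_bool (j = i) + of_bool (j = i - 1)) \<cdot>\<^sub>v heis_z n"
    unfolding heis_bracket_def s1'[symmetric] s2'[symmetric] sum_negf[symmetric]
    using i j by (intro arg_cong[where f = "\<lambda>t. t \<cdot>\<^sub>v heis_z n"] arg_cong2[where f = "(+)"] sum.cong)
      (auto simp: coord_basis)
  then show "heis_bracket n (heis_f n j) (heis_e n i) =
      (if j = i then - heis_z n else if j = i - 1 then heis_z n else 0\<^sub>v (2 * n + 1))"
    using ne zero neg by auto
  have br0: "heis_bracket n x y = 0\<^sub>v (2 * n + 1)"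
    if "\<And>k l. 1 \<le> k \<Longrightarrow> k \<le> n \<Longrightarrow> 1 \<le> l \<Longrightarrow> l \<le> n \<Longrightarrow>
      coord_e x k * coord_f n y l = 0 \<and> coord_f n x k * coord_e y l = 0" for x y
  proof -
    have "(\<Sum>k = 1..n. coord_e x k * coord_f n y k - coord_f n x k * coord_e y k) = 0"
    proof (rule sum.neutral, rule ballI)
      fix k assume "k \<in> {1..n}"
      then show "coord_e x k * coord_f n y k - coord_f n x k * coord_e y k = 0"
        using that[of k k] by auto
    qed
    moreover have "(\<Sum>k = 2..n. coord_e x k * coord_f n y (k - 1) + coord_f n x (k - 1) * coord_e y k) = 0"
    proof (rule sum.neutral, rule ballI)
      fix k assume "k \<in> {2..n}"
      then have "1 \<le> k" "k \<le> n" "1 \<le> k - 1" "k - 1 \<le> n" by auto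
      then show "coord_e x k * coord_f n y (k - 1) + coord_f n x (k - 1) * coord_e y k = 0"
        using that[of k "k - 1"] that[of "k - 1" k] by auto
    qed
    ultimately show ?thesis
      unfolding heis_bracket_def using zero by simp
  qed
  show "heis_bracket n (heis_e n i) (heis_e n j) = 0\<^sub>v (2 * n + 1)"
    "heis_bracket n (heis_f n i) (heis_f n j) = 0\<^sub>v (2 * n + 1)"
    "heis_bracket n (heis_e n i) (heis_z n) = 0\<^sub>v (2 * n + 1)"
    "heis_bracket n (heis_z n) (heis_e n i) = 0\<^sub>v (2 * n + 1)"
    "heis_bracket n (heis_f n i) (heis_z n) = 0\<^sub>v (2 * n + 1)"
    "heis_bracket n (heis_z n) (heis_f n i) = 0\<^sub>v (2 * n + 1)"
    "heis_bracket n (heis_z n) (heis_z n) = 0\<^sub>v (2 * n + 1)"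
    by (rule br0, use coord_basis[OF i] coord_basis[OF j] in simp)+
qed


section \<open>Derivations and their matrices\<close>

definition derivation_on ::
  "nat \<Rightarrow> (complex vec \<Rightarrow> complex vec \<Rightarrow> complex vec) \<Rightarrow> (complex vec \<Rightarrow> complex vec) \<Rightarrow> bool" where
  "derivation_on m br d \<longleftrightarrow>
     linear_map class_ring (module_vec TYPE(complex) m) (module_vec TYPE(complex) m) d \<and>
     (\<forall>x \<in> carrier_vec m. \<forall>y \<in> carrier_vec m. d (br x y) = br (d x) y + br x (d y))"

definition heis_derivation :: "nat \<Rightarrow> (complex vec \<Rightarrow> complex vec) \<Rightarrow> bool" where
  "heis_derivation n d \<longleftrightarrow> derivation_on (2 * n + 1) (heis_bracket n) d"

definition heis_matrix :: "nat \<Rightarrow> (complex vec \<Rightarrow> complex vec) \<Rightarrow> complex mat" where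
  "heis_matrix n d = mat_of_cols (2 * n + 1) (map d (heis_basis n))"

lemma linear_map_vec_iff:
  "linear_map class_ring (module_vec TYPE(complex) m) (module_vec TYPE(complex) m) d \<longleftrightarrow>
     d \<in> carrier_vec m \<rightarrow> carrier_vec m \<and>
     (\<forall>x \<in> carrier_vec m. \<forall>y \<in> carrier_vec m. d (x + y) = d x + d y) \<and>
     (\<forall>c. \<forall>x \<in> carrier_vec m. d (c \<cdot>\<^sub>v x) = c \<cdot>\<^sub>v d x)"
proof -
  interpret vec_space "TYPE(complex)" m .
  have V: "Module.module class_ring V" "vectorspace class_ring V"
    by unfold_locales
  show ?thesis
    using V by (auto simp: linear_map_def mod_hom_def mod_hom_axioms_def LinearCombinations.module_hom_def
        module_vec_simps Pi_iff)
qed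


section \<open>Block matrices\<close>

text \<open>The matrix with entries \<open>a i j\<close>, where \<open>i\<close> and \<open>j\<close> start at 1.\<close>

definition mat1 :: "nat \<Rightarrow> nat \<Rightarrow> (nat \<Rightarrow> nat \<Rightarrow> complex) \<Rightarrow> complex mat" where
  "mat1 r k a = mat r k (\<lambda>(i, j). a (i + 1) (j + 1))"

definition block_A :: "nat \<Rightarrow> (nat \<Rightarrow> complex) \<Rightarrow> complex mat" where
  "block_A n \<alpha> = mat1 n n (\<lambda>i j. if i \<le> j then \<alpha> (j - i + 1) else 0)"

definition block_D :: "nat \<Rightarrow> (nat \<Rightarrow> complex) \<Rightarrow> complex \<Rightarrow> complex mat" where
  "block_D n \<alpha> \<beta>\<^sub>1 =
     mat1 n n (\<lambda>i j. if i = j then \<beta>\<^sub>1 else if i > j then - \<alpha> (i - j + 1) else 0)"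

definition block_B :: "nat \<Rightarrow> (nat \<Rightarrow> complex) \<Rightarrow> complex mat" where
  "block_B n b =
     mat1 n n (\<lambda>i j. if even (i + j) \<and> i + j \<ge> n + 1 then (- 1) ^ (i + 1) * b (i + j) else 0)"

definition block_C :: "nat \<Rightarrow> (nat \<Rightarrow> complex) \<Rightarrow> complex mat" where
  "block_C n c =
     mat1 n n (\<lambda>i j. if even (i + j) \<and> i + j \<le> n + 1 then (- 1) ^ (i + 1) * c (i + j) else 0)"

end

theory Submission
  imports Defs
begin

text \<open>
  Brackets lie in \<open>\<complex> z\<close> and \<open>z\<close> is central, so a derivation multiplies \<open>z = [e\<^sub>1, f\<^sub>1]\<close> by a scalar
  \<open>\<gamma>\<close>, and the \<open>z\<close>-coordinates \<open>\<mu>, \<nu>\<close> of the other images are unconstrained. What remains is a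
  \<open>2n \<times> 2n\<close> matrix \<open>M\<close> with blocks \<open>A, B, C, D\<close> satisfying \<open>\<omega>(Mx, y) + \<omega>(x, My) = \<gamma> \<omega>(x, y)\<close>,
  where \<open>[x, y] = \<omega>(x, y) z\<close>. The form \<open>\<omega>\<close> is the sum of the standard symplectic form
  and of a symmetric form that pairs \<open>e\<^sub>i\<close> with \<open>f\<^sub>i\<^sub>-\<^sub>1\<close>; exchanging \<open>x\<close> and \<open>y\<close> shows that \<open>M\<close>
  satisfies the condition for each of the two separately.

  The symplectic part makes \<open>B\<close> and \<open>C\<close> symmetric and gives \<open>D = \<gamma> - A\<^sup>T\<close>. The symmetric part then says
  that \<open>A\<close> is constant along diagonals, whereas \<open>B\<close> and \<open>C\<close> change sign at every step along an
  antidiagonal. The symmetric form has no partner for \<open>e\<^sub>1\<close> and \<open>f\<^sub>n\<close>, which forces the first column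
  of \<open>A\<close> and of \<open>B\<close> and the last column of \<open>C\<close> to vanish except for one entry each; following the
  diagonals or antidiagonals to these columns yields the zero patterns. Finally an alternating antidiagonal
  with \<open>i + j\<close> odd also has to be symmetric, hence is zero
  (\<open>antidiagonal_odd\<close>). The three patterns are \<open>toeplitz_pattern\<close>, \<open>hankel_low_pattern\<close> and
  \<open>hankel_high_pattern\<close>.
\<close>

section \<open>Matrices alternating along antidiagonals\<close>

lemma antidiagonal_shift:
  fixes X :: "nat \<Rightarrow> nat \<Rightarrow> complex"
  assumes alt: "\<And>i j. \<lbrakk>1 \<le> i; i < n; 1 \<le> j; j < n\<rbrakk> \<Longrightarrow> X (i + 1) j = - X i (j + 1)"
  shows "\<lbrakk>1 \<le> i; 1 \<le> j; i + k \<le> n; j + k \<le> n\<rbrakk> \<Longrightarrow> X (i + k) j = (- 1) ^ k * X i (j + k)"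
proof (induction k arbitrary: j)
  case (Suc k)
  have "X (i + Suc k) j = - X (i + k) (j + 1)"
    using alt[of "i + k" j] Suc.prems by simp
  also have "\<dots> = (- 1) ^ Suc k * X i (j + Suc k)"
    using Suc.IH[of "j + 1"] Suc.prems by simp
  finally show ?case .
qed simp

text \<open>Reflecting an entry in the diagonal takes \<open>j - i\<close> sign changes, an odd number.\<close>

lemma antidiagonal_odd:
  fixes X :: "nat \<Rightarrow> nat \<Rightarrow> complex"
  assumes alt: "\<And>i j. \<lbrakk>1 \<le> i; i < n; 1 \<le> j; j < n\<rbrakk> \<Longrightarrow> X (i + 1) j = - X i (j + 1)"
    and sym: "\<And>i j. \<lbrakk>1 \<le> i; i \<le> n; 1 \<le> j; j \<le> n\<rbrakk> \<Longrightarrow> X i j = X j i"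
    and ij: "1 \<le> i" "i \<le> n" "1 \<le> j" "j \<le> n" "odd (i + j)"
  shows "X i j = 0"
proof -
  have *: "X i j = 0" if "1 \<le> i" "i \<le> j" "j \<le> n" "odd (i + j)" for i j
  proof -
    have "X (i + (j - i)) i = (- 1) ^ (j - i) * X i (i + (j - i))"
      using that by (intro antidiagonal_shift[where n = n] alt) auto
    moreover have "odd (j - i)" using that by auto
    ultimately have "X j i = - X i j" using that by simp
    then show ?thesis using sym[of i j] that by simp
  qed
  show ?thesis
    using *[of i j] *[of j i] sym[of i j] ij by (cases "i \<le> j") (auto simp: add.commute)
qed

text \<open>
  The parameter of an antidiagonal \<open>h \<ge> n + 1\<close> is read off where it meets the last row. An antidiagonal
  \<open>h \<le> n\<close> meets the first column in row \<open>h - 1 < n\<close>.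
\<close>

lemma hankel_high_pattern:
  fixes X :: "nat \<Rightarrow> nat \<Rightarrow> complex"
  assumes alt: "\<And>i j. \<lbrakk>1 \<le> i; i < n; 1 \<le> j; j < n\<rbrakk> \<Longrightarrow> X (i + 1) j = - X i (j + 1)"
    and sym: "\<And>i j. \<lbrakk>1 \<le> i; i \<le> n; 1 \<le> j; j \<le> n\<rbrakk> \<Longrightarrow> X i j = X j i"
    and zero: "\<And>i. \<lbrakk>1 \<le> i; i < n\<rbrakk> \<Longrightarrow> X i 1 = 0"
    and ij: "1 \<le> i" "i \<le> n" "1 \<le> j" "j \<le> n"
  shows "X i j = (if even (i + j) \<and> n + 1 \<le> i + j
    then (- 1) ^ (i + 1) * ((- 1) ^ (n + 1) * X n (i + j - n)) else 0)"
proof (cases "n + 1 \<le> i + j")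
  case True
  have "X (i + (n - i)) (i + j - n) = (- 1) ^ (n - i) * X i ((i + j - n) + (n - i))"
    using True ij by (intro antidiagonal_shift[where n = n] alt) auto
  then have "X n (i + j - n) = (- 1) ^ (n - i) * X i j"
    using True ij by simp
  moreover have "(- 1) ^ (i + 1) * ((- 1) ^ (n + 1) * (- 1) ^ (n - i)) = (1 :: complex)"
    using ij by (simp flip: power_add)
  ultimately have "X i j = (- 1) ^ (i + 1) * ((- 1) ^ (n + 1) * X n (i + j - n))"
    by (metis mult.assoc mult_1)
  moreover have "X i j = 0" if "odd (i + j)"
    using alt sym ij that by (rule antidiagonal_odd)
  ultimately show ?thesis using True by auto
next
  case False
  have "X (i + (j - 1)) 1 = (- 1) ^ (j - 1) * X i (1 + (j - 1))"
    using False ij by (intro antidiagonal_shift[where n = n] alt) auto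
  then show ?thesis using zero[of "i + (j - 1)"] False ij by simp
qed

text \<open>
  Likewise with the first row in place of the last one, and the last column in place of the first
  one: an antidiagonal \<open>h \<ge> n + 2\<close> meets it in row \<open>h - n \<ge> 2\<close>.
\<close>

lemma hankel_low_pattern:
  fixes X :: "nat \<Rightarrow> nat \<Rightarrow> complex"
  assumes alt: "\<And>i j. \<lbrakk>1 \<le> i; i < n; 1 \<le> j; j < n\<rbrakk> \<Longrightarrow> X (i + 1) j = - X i (j + 1)"
    and sym: "\<And>i j. \<lbrakk>1 \<le> i; i \<le> n; 1 \<le> j; j \<le> n\<rbrakk> \<Longrightarrow> X i j = X j i"
    and zero: "\<And>i. \<lbrakk>1 < i; i \<le> n\<rbrakk> \<Longrightarrow> X i n = 0"
    and ij: "1 \<le> i" "i \<le> n" "1 \<le> j" "j \<le> n"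
  shows "X i j = (if even (i + j) \<and> i + j \<le> n + 1
    then (- 1) ^ (i + 1) * X 1 (i + j - 1) else 0)"
proof (cases "i + j \<le> n + 1")
  case True
  have "X (1 + (i - 1)) j = (- 1) ^ (i - 1) * X 1 (j + (i - 1))"
    using True ij by (intro antidiagonal_shift[where n = n] alt) auto
  moreover have "(- 1) ^ (i + 1) = ((- 1) ^ (i - 1) :: complex)"
    using ij by (cases i) auto
  moreover have "j + (i - 1) = i + j - 1" using ij by simp
  ultimately have "X i j = (- 1) ^ (i + 1) * X 1 (i + j - 1)"
    using ij by simp
  moreover have "X i j = 0" if "odd (i + j)"
    using alt sym ij that by (rule antidiagonal_odd)
  ultimately show ?thesis using True by auto
next
  case False
  have "X (i + j - n + (n - j)) j = (- 1) ^ (n - j) * X (i + j - n) (j + (n - j))"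
    using False ij by (intro antidiagonal_shift[where n = n] alt) auto
  then show ?thesis using zero[of "i + j - n"] False ij by simp
qed

section \<open>Matrices constant along diagonals\<close>

lemma diagonal_shift:
  fixes X :: "nat \<Rightarrow> nat \<Rightarrow> complex"
  assumes const: "\<And>i j. \<lbrakk>1 \<le> i; i < n; 1 \<le> j; j < n\<rbrakk> \<Longrightarrow> X (i + 1) (j + 1) = X i j"
  shows "\<lbrakk>1 \<le> i; 1 \<le> j; i + k \<le> n; j + k \<le> n\<rbrakk> \<Longrightarrow> X (i + k) (j + k) = X i j"
proof (induction k)
  case (Suc k)
  then show ?case using const[of "i + k" "j + k"] by simp
qed simp

lemma toeplitz_pattern:
  fixes X :: "nat \<Rightarrow> nat \<Rightarrow> complex"
  assumes const: "\<And>i j. \<lbrakk>1 \<le> i; i < n; 1 \<le> j; j < n\<rbrakk> \<Longrightarrow> X (i + 1) (j + 1) = X i j"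
    and zero: "\<And>i. \<lbrakk>1 < i; i \<le> n\<rbrakk> \<Longrightarrow> X i 1 = 0"
    and ij: "1 \<le> i" "i \<le> n" "1 \<le> j" "j \<le> n"
  shows "X i j = (if i \<le> j then X 1 (j - i + 1) else 0)"
proof (cases "i \<le> j")
  case True
  have "X (1 + (i - 1)) (j - i + 1 + (i - 1)) = X 1 (j - i + 1)"
    by (rule diagonal_shift[where X = X and n = n], erule (3) const) (use True ij in auto)
  then show ?thesis using True ij by simp
next
  case False
  have "X (i - j + 1 + (j - 1)) (1 + (j - 1)) = X (i - j + 1) 1"
    by (rule diagonal_shift[where X = X and n = n], erule (3) const) (use False ij in auto)
  then show ?thesis using zero[of "i - j + 1"] False ij by simp
qed

section \<open>The bracket with a basis vector\<close>

text \<open>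
  Coordinates continued by zero: with them the neighbours \<open>e\<^sub>n\<^sub>+\<^sub>1\<close> and \<open>f\<^sub>0\<close> that the symmetric form lacks
  need no case distinction.
\<close>

definition coord_e0 :: "nat \<Rightarrow> complex vec \<Rightarrow> nat \<Rightarrow> complex" where
  "coord_e0 n x i = (if 1 \<le> i \<and> i \<le> n then coord_e x i else 0)"

definition coord_f0 :: "nat \<Rightarrow> complex vec \<Rightarrow> nat \<Rightarrow> complex" where
  "coord_f0 n x i = (if 1 \<le> i \<and> i \<le> n then coord_f n x i else 0)"

lemma heis_bracket_e_right:
  assumes "1 \<le> k" "k \<le> n"
  shows "heis_bracket n x (heis_e n k) = (coord_f0 n x (k - 1) - coord_f0 n x k) \<cdot>\<^sub>v heis_z n"
proof -
  have 1: "(\<Sum>i = 1..n. coord_e x i * coord_f n (heis_e n k) i - coord_f n x i * coord_e (heis_e n k) i)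
      = (\<Sum>i = 1..n. if i = k then - coord_f n x k else 0)"
    using assms by (intro sum.cong) (auto simp: coord_basis)
  have 2: "(\<Sum>i = 2..n. coord_e x i * coord_f n (heis_e n k) (i - 1)
        + coord_f n x (i - 1) * coord_e (heis_e n k) i)
      = (\<Sum>i = 2..n. if i = k then coord_f n x (k - 1) else 0)"
    using assms by (intro sum.cong) (auto simp: coord_basis)
  show ?thesis
    unfolding heis_bracket_def 1 2 using assms by (auto simp: coord_f0_def)
qed

lemma heis_bracket_e_left:
  assumes "1 \<le> k" "k \<le> n"
  shows "heis_bracket n (heis_e n k) x = (coord_f0 n x (k - 1) + coord_f0 n x k) \<cdot>\<^sub>v heis_z n"
proof -
  have 1: "(\<Sum>i = 1..n. coord_e (heis_e n k) i * coord_f n x i - coord_f n (heis_e n k) i * coord_e x i)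
      = (\<Sum>i = 1..n. if i = k then coord_f n x k else 0)"
    using assms by (intro sum.cong) (auto simp: coord_basis)
  have 2: "(\<Sum>i = 2..n. coord_e (heis_e n k) i * coord_f n x (i - 1)
        + coord_f n (heis_e n k) (i - 1) * coord_e x i)
      = (\<Sum>i = 2..n. if i = k then coord_f n x (k - 1) else 0)"
    using assms by (intro sum.cong) (auto simp: coord_basis)
  show ?thesis
    unfolding heis_bracket_def 1 2 using assms by (auto simp: coord_f0_def)
qed

lemma heis_bracket_f_right:
  assumes "1 \<le> k" "k \<le> n"
  shows "heis_bracket n x (heis_f n k) = (coord_e0 n x (k + 1) + coord_e0 n x k) \<cdot>\<^sub>v heis_z n"
proof -
  have 1: "(\<Sum>i = 1..n. coord_e x i * coord_f n (heis_f n k) i - coord_f n x i * coord_e (heis_f n k) i)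
      = (\<Sum>i = 1..n. if i = k then coord_e x k else 0)"
    using assms by (intro sum.cong) (auto simp: coord_basis)
  have 2: "(\<Sum>i = 2..n. coord_e x i * coord_f n (heis_f n k) (i - 1)
        + coord_f n x (i - 1) * coord_e (heis_f n k) i)
      = (\<Sum>i = 2..n. if i = k + 1 then coord_e x (k + 1) else 0)"
    using assms by (intro sum.cong) (auto simp: coord_basis)
  show ?thesis
    unfolding heis_bracket_def 1 2 using assms by (auto simp: coord_e0_def)
qed

lemma heis_bracket_f_left:
  assumes "1 \<le> k" "k \<le> n"
  shows "heis_bracket n (heis_f n k) x = (coord_e0 n x (k + 1) - coord_e0 n x k) \<cdot>\<^sub>v heis_z n"
proof -
  have 1: "(\<Sum>i = 1..n. coord_e (heis_f n k) i * coord_f n x i - coord_f n (heis_f n k) i * coord_e x i)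
      = (\<Sum>i = 1..n. if i = k then - coord_e x k else 0)"
    using assms by (intro sum.cong) (auto simp: coord_basis)
  have 2: "(\<Sum>i = 2..n. coord_e (heis_f n k) i * coord_f n x (i - 1)
        + coord_f n (heis_f n k) (i - 1) * coord_e x i)
      = (\<Sum>i = 2..n. if i = k + 1 then coord_e x (k + 1) else 0)"
    using assms by (intro sum.cong) (auto simp: coord_basis)
  show ?thesis
    unfolding heis_bracket_def 1 2 using assms by (auto simp: coord_e0_def)
qed

lemma coord0_basis:
  assumes "1 \<le> j" "j \<le> n"
  shows "coord_e0 n (heis_e n j) i = of_bool (i = j)" "coord_f0 n (heis_e n j) i = 0"
    "coord_e0 n (heis_f n j) i = 0" "coord_f0 n (heis_f n j) i = of_bool (i = j)"
  using assms by (auto simp: coord_e0_def coord_f0_def coord_basis)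

section \<open>Derivations\<close>

theorem mainTheorem5:
  fixes n :: nat and d :: "complex vec \<Rightarrow> complex vec"
  assumes "n \<ge> 1" and "heis_derivation n d"
  shows "\<exists>(\<alpha> :: nat \<Rightarrow> complex) (\<beta>\<^sub>1 :: complex) (b :: nat \<Rightarrow> complex) (c :: nat \<Rightarrow> complex)
           (\<gamma> :: complex) (\<mu> :: complex vec) (\<nu> :: complex vec).
      \<mu> \<in> carrier_vec n \<and> \<nu> \<in> carrier_vec n \<and> \<gamma> = \<alpha> 1 + \<beta>\<^sub>1 \<and>
      heis_matrix n d =
        four_block_mat
          (four_block_mat (block_A n \<alpha>) (block_C n c) (block_B n b) (block_D n \<alpha> \<beta>\<^sub>1))
          (0\<^sub>m (2 * n) 1)
          (mat_of_row (\<mu> @\<^sub>v \<nu>))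
          (mat 1 1 (\<lambda>_. \<gamma>))"
proof -
  let ?V = "carrier_vec (2 * n + 1) :: complex vec set"
  note n = assms(1)
  have d: "\<forall>s. \<forall>x \<in> ?V. d (s \<cdot>\<^sub>v x) = s \<cdot>\<^sub>v d x"
      "\<forall>x \<in> ?V. \<forall>y \<in> ?V. d (heis_bracket n x y) = heis_bracket n (d x) y + heis_bracket n x (d y)"
    using assms(2) unfolding heis_derivation_def derivation_on_def linear_map_vec_iff by blast+
  have scale: "d (s \<cdot>\<^sub>v x) = s \<cdot>\<^sub>v d x" if "x \<in> ?V" for s x
    using d(1) that by blast
  have leibniz: "d (heis_bracket n x y) = heis_bracket n (d x) y + heis_bracket n x (d y)"
    if "x \<in> ?V" "y \<in> ?V" for x y
    using d(2) that by blast
  have basis_in: "heis_e n i \<in> ?V" "heis_f n i \<in> ?V" "heis_z n \<in> ?V" for i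
    by (auto simp: heis_e_def heis_f_def heis_z_def)

  have combine: "s \<cdot>\<^sub>v heis_z n + t \<cdot>\<^sub>v heis_z n = (s + t) \<cdot>\<^sub>v heis_z n" for s t
    by (simp add: add_smult_distrib_vec)
  obtain \<gamma> where dz: "d (heis_z n) = \<gamma> \<cdot>\<^sub>v heis_z n"
  proof -
    have "d (heis_z n) = d (heis_bracket n (heis_e n 1) (heis_f n 1))"
      using n by (simp add: heis_bracket_basis)
    also have "\<dots> = heis_bracket n (d (heis_e n 1)) (heis_f n 1)
        + heis_bracket n (heis_e n 1) (d (heis_f n 1))"
      by (intro leibniz basis_in)
    finally show ?thesis
      using that n by (simp only: heis_bracket_f_right heis_bracket_e_left combine)
  qed
  have z_cancel: "s = t" if "s \<cdot>\<^sub>v heis_z n = t \<cdot>\<^sub>v heis_z n" for s t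
    using arg_cong[OF that, of "\<lambda>v. v $ (2 * n)"] by (simp add: heis_z_def)

  define A where "A i j = coord_e0 n (d (heis_e n j)) i" for i j
  define B where "B i j = coord_f0 n (d (heis_e n j)) i" for i j
  define C where "C i j = coord_e0 n (d (heis_f n j)) i" for i j
  define D where "D i j = coord_f0 n (d (heis_f n j)) i" for i j
  note block_defs = A_def B_def C_def D_def
  have pad: "B 0 j = 0" "D 0 j = 0" "A (Suc n) j = 0" "C (Suc n) j = 0" for j
    by (auto simp: block_defs coord_e0_def coord_f0_def)

  have leib: "t * \<gamma> = r + s"
    if "x \<in> ?V" "y \<in> ?V" "heis_bracket n x y = t \<cdot>\<^sub>v heis_z n"
      "heis_bracket n (d x) y = r \<cdot>\<^sub>v heis_z n" "heis_bracket n x (d y) = s \<cdot>\<^sub>v heis_z n" for x y r s t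
    using leibniz[OF that(1,2)] that(3-) basis_in(3)
    by (intro z_cancel) (simp add: scale dz combine smult_smult_assoc)

  have ee: "(B (k - 1) j - B k j) + (B (j - 1) k + B j k) = 0"
    and ff: "(C (j + 1) k - C j k) + (C (k + 1) j + C k j) = 0"
    and ef: "(of_bool (j - 1 = k) + of_bool (j = k)) * \<gamma> =
      (A (k + 1) j + A k j) + (D (j - 1) k + D j k)"
    and fe: "(of_bool (j - 1 = k) - of_bool (j = k)) * \<gamma> =
      (D (j - 1) k - D j k) + (A (k + 1) j - A k j)"
    if j: "1 \<le> j" "j \<le> n" and k: "1 \<le> k" "k \<le> n" for j k
  proof -
    show "(B (k - 1) j - B k j) + (B (j - 1) k + B j k) = 0"
      using leib[OF basis_in(1) basis_in(1) heis_bracket_e_left[OF j]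
          heis_bracket_e_right[OF k] heis_bracket_e_left[OF j]] j k
      by (simp add: coord0_basis block_defs)
    show "(C (j + 1) k - C j k) + (C (k + 1) j + C k j) = 0"
      using leib[OF basis_in(2) basis_in(2) heis_bracket_f_left[OF j]
          heis_bracket_f_right[OF k] heis_bracket_f_left[OF j]] j k
      by (simp add: coord0_basis block_defs add.commute)
    show "(of_bool (j - 1 = k) + of_bool (j = k)) * \<gamma> =
        (A (k + 1) j + A k j) + (D (j - 1) k + D j k)"
      using leib[OF basis_in(1) basis_in(2) heis_bracket_e_left[OF j]
          heis_bracket_f_right[OF k] heis_bracket_e_left[OF j]] j k
      by (simp add: coord0_basis block_defs)
    show "(of_bool (j - 1 = k) - of_bool (j = k)) * \<gamma> =
        (D (j - 1) k - D j k) + (A (k + 1) j - A k j)"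
      using leib[OF basis_in(2) basis_in(1) heis_bracket_e_right[OF j]
          heis_bracket_e_right[OF j] heis_bracket_f_left[OF k]] j k
      by (simp add: coord0_basis block_defs)
  qed

  \<comment> \<open>The two equations come from the two orders of the arguments. Half their difference is the
    symplectic part \<open>y - x\<close>, half their sum the symmetric part \<open>q + p\<close>.\<close>
  have separate: "x = y" "q = - p" if "(p - x) + (q + y) = 0" "(q - y) + (p + x) = 0"
    for p q x y :: complex
  proof -
    have "2 * (y - x) = ((p - x) + (q + y)) - ((q - y) + (p + x))" by (simp add: algebra_simps)
    then show "x = y" unfolding that by simp
    have "2 * (q + p) = ((p - x) + (q + y)) + ((q - y) + (p + x))" by (simp add: algebra_simps)
    then have "q + p = 0" unfolding that by (simp del: distrib_left_numeral)
    then show "q = - p" by (simp add: eq_neg_iff_add_eq_0)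
  qed
  have B_sym: "B j k = B k j" and B_alt: "B (j - 1) k = - B (k - 1) j"
    if "1 \<le> j" "j \<le> n" "1 \<le> k" "k \<le> n" for j k
    using separate[OF ee[of j k] ee[of k j]] that by auto
  have C_sym: "C j k = C k j" and C_alt: "C (k + 1) j = - C (j + 1) k"
    if "1 \<le> j" "j \<le> n" "1 \<le> k" "k \<le> n" for j k
    using separate[OF ff[of j k] ff[of k j]] that by auto
  have D_eq: "D j k = of_bool (j = k) * \<gamma> - A k j"
    and AD: "A (k + 1) j = of_bool (j - 1 = k) * \<gamma> - D (j - 1) k"
    if jk: "1 \<le> j" "j \<le> n" "1 \<le> k" "k \<le> n" for j k
  proof -
    \<comment> \<open>Absorbing \<open>\<gamma>\<close> into the entries of \<open>A\<close> makes the equations homogeneous.\<close>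
    let ?p = "A (k + 1) j - of_bool (j - 1 = k) * \<gamma>" and ?x = "A k j - of_bool (j = k) * \<gamma>"
    have "(?p - ?x) + (D (j - 1) k + - D j k) = 0" "(D (j - 1) k - - D j k) + (?p + ?x) = 0"
      using ef[OF jk] fe[OF jk] by (simp_all only: algebra_simps) (simp_all add: algebra_simps)
    from separate[OF this] show "D j k = of_bool (j = k) * \<gamma> - A k j"
      and "A (k + 1) j = of_bool (j - 1 = k) * \<gamma> - D (j - 1) k"
      by (simp_all add: algebra_simps)
  qed

  define \<alpha> where "\<alpha> m = A 1 m" for m
  define b where "b h = (- 1) ^ (n + 1) * B n (h - n)" for h
  define c where "c h = C 1 (h - 1)" for h
  define \<beta> where "\<beta> = \<gamma> - \<alpha> 1"

  have A_pat: "A i j = (if i \<le> j then \<alpha> (j - i + 1) else 0)"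
    if "1 \<le> i" "i \<le> n" "1 \<le> j" "j \<le> n" for i j
    unfolding \<alpha>_def
  proof (rule toeplitz_pattern[OF _ _ that])
    fix i j assume ij: "1 \<le> i" "i < n" "1 \<le> j" "j < n"
    then show "A (i + 1) (j + 1) = A i j"
      using AD[of "j + 1" i] D_eq[of j i] by simp
  next
    fix i assume "1 < i" "i \<le> n"
    then show "A i 1 = 0" using AD[of 1 "i - 1"] pad by simp
  qed
  have B_pat: "B i j = (if even (i + j) \<and> n + 1 \<le> i + j then (- 1) ^ (i + 1) * b (i + j) else 0)"
    if "1 \<le> i" "i \<le> n" "1 \<le> j" "j \<le> n" for i j
    unfolding b_def
  proof (rule hankel_high_pattern[OF _ B_sym _ that])
    fix i j assume ij: "1 \<le> i" "i < n" "1 \<le> j" "j < n"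
    then show "B (i + 1) j = - B i (j + 1)"
      using B_alt[of "i + 1" "j + 1"] B_sym[of "i + 1" j] by simp
  next
    fix i assume "1 \<le> i" "i < n"
    then show "B i 1 = 0" using B_alt[of "i + 1" 1] pad by simp
  qed
  have C_pat: "C i j = (if even (i + j) \<and> i + j \<le> n + 1 then (- 1) ^ (i + 1) * c (i + j) else 0)"
    if "1 \<le> i" "i \<le> n" "1 \<le> j" "j \<le> n" for i j
    unfolding c_def
  proof (rule hankel_low_pattern[OF _ C_sym _ that])
    fix i j assume ij: "1 \<le> i" "i < n" "1 \<le> j" "j < n"
    then show "C (i + 1) j = - C i (j + 1)"
      using C_alt[of j i] C_sym[of "j + 1" i] by simp
  next
    fix i assume "1 < i" "i \<le> n"
    then show "C i n = 0" using C_alt[of "i - 1" n] pad n by simp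
  qed
  have D_pat: "D i j = (if i = j then \<beta> else if j < i then - \<alpha> (i - j + 1) else 0)"
    if "1 \<le> i" "i \<le> n" "1 \<le> j" "j \<le> n" for i j
    using that by (auto simp: D_eq A_pat \<beta>_def)

  define \<mu> where "\<mu> = vec n (\<lambda>j. d (heis_e n (j + 1)) $ (2 * n))"
  define \<nu> where "\<nu> = vec n (\<lambda>j. d (heis_f n (j + 1)) $ (2 * n))"

  have col: "heis_basis n ! j =
      (if j < n then heis_e n (j + 1) else if j < 2 * n then heis_f n (j - n + 1) else heis_z n)"
    if "j < 2 * n + 1" for j
    using that by (auto simp: heis_basis_def nth_append simp del: upt_Suc)
  have len: "length (heis_basis n) = 2 * n + 1"
    by (simp add: heis_basis_def)
  have entry: "heis_matrix n d $$ (i, j) = d (heis_basis n ! j) $ i"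
    if "i < 2 * n + 1" "j < 2 * n + 1" for i j
    using that len by (simp add: heis_matrix_def mat_of_cols_index)

  have z_entry: "heis_z n $ i = of_bool (i = 2 * n)" "(\<gamma> \<cdot>\<^sub>v heis_z n) $ i = \<gamma> * heis_z n $ i"
    if "i < 2 * n + 1" for i
    using that by (auto simp: heis_z_def)

  let ?N = "four_block_mat (block_A n \<alpha>) (block_C n c) (block_B n b) (block_D n \<alpha> \<beta>)"
  let ?M = "four_block_mat ?N (0\<^sub>m (2 * n) 1) (mat_of_row (\<mu> @\<^sub>v \<nu>)) (mat 1 1 (\<lambda>_. \<gamma>))"
  have dims: "block_A n \<alpha> \<in> carrier_mat n n" "block_B n b \<in> carrier_mat n n"
    "block_C n c \<in> carrier_mat n n" "block_D n \<alpha> \<beta> \<in> carrier_mat n n"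
    by (simp_all add: block_A_def block_B_def block_C_def block_D_def mat1_def)
  have blocks: "block_A n \<alpha> $$ (i, j) = d (heis_e n (j + 1)) $ i"
      "block_B n b $$ (i, j) = d (heis_e n (j + 1)) $ (n + i)"
      "block_C n c $$ (i, j) = d (heis_f n (j + 1)) $ i"
      "block_D n \<alpha> \<beta> $$ (i, j) = d (heis_f n (j + 1)) $ (n + i)"
    if "i < n" "j < n" for i j
    using that A_pat[of "i + 1" "j + 1"] B_pat[of "i + 1" "j + 1"]
      C_pat[of "i + 1" "j + 1"] D_pat[of "i + 1" "j + 1"]
    by (simp_all add: block_A_def block_B_def block_C_def block_D_def mat1_def
        block_defs coord_e0_def coord_f0_def coord_e_def coord_f_def)
  have "heis_matrix n d = ?M"
  proof (rule eq_matI)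
    fix i j assume "i < dim_row ?M" "j < dim_col ?M"
    then have ij: "i < 2 * n + 1" "j < 2 * n + 1" using dims by auto
    have "?M $$ (i, j) =
        (if i < 2 * n then if j < 2 * n then ?N $$ (i, j) else 0
         else if j < n then \<mu> $ j else if j < 2 * n then \<nu> $ (j - n) else \<gamma>)"
      using ij dims by (auto simp: \<mu>_def \<nu>_def mat_of_row_index)
    also have "\<dots> = d (heis_basis n ! j) $ i"
    proof (cases "i < 2 * n")
      case True
      show ?thesis
      proof (cases "j < 2 * n")
        case j: True
        have "?N $$ (i, j) =
            (if i < n then if j < n then block_A n \<alpha> $$ (i, j) else block_C n c $$ (i, j - n)
             else if j < n then block_B n b $$ (i - n, j) else block_D n \<alpha> \<beta> $$ (i - n, j - n))"
          using True j dims by auto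
        then show ?thesis using True j by (auto simp: col blocks)
      next
        case False
        then show ?thesis using ij True by (simp add: col dz z_entry)
      qed
    next
      case False
      then have "i = 2 * n" using ij by simp
      then show ?thesis using ij by (auto simp: col dz z_entry \<mu>_def \<nu>_def)
    qed
    finally show "heis_matrix n d $$ (i, j) = ?M $$ (i, j)"
      using entry[OF ij] by simp
  qed (use dims len in \<open>auto simp: heis_matrix_def\<close>)
  moreover have "\<mu> \<in> carrier_vec n" "\<nu> \<in> carrier_vec n" "\<gamma> = \<alpha> 1 + \<beta>"
    by (simp_all add: \<mu>_def \<nu>_def \<beta>_def)
  ultimately show ?thesis by blast
qed

end
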